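(* Let $M=\begin{pmatrix}a&b\\c&d\end{pmatrix}\in \mathrm{SL}_2(\mathbb{R})$ and let $f:\mathbb{R}\to\mathbb{C}$ be non-zero (i.e. not a.e. zero) with $f\in L^1(\mathbb{R})$ and $L_Mf\in L^1(\mathbb{R})$. Then \[ \lambda(\operatorname{supp}(f))\cdot\lambda(\operatorname{supp}(L_Mf))\ \ge\ |b|, \] where $\lambda$ denotes Lebesgue measure.
   Context: For $M=\begin{pmatrix}a&b\\c&d\end{pmatrix}\in\mathrm{SL}_2(\mathbb{R})$ with $b\ne0$, the linear canonical transformation $L_M$ is defined for $f\in L^1(\mathbb{R})$ by \[ (L_Mf)(\xi)=\frac{e^{-i\pi\operatorname{sgn}(b)/4}}{\sqrt{|b|}}\int_{\mathbb{R}} f(x)\,e^{i\pi(d\xi^2-2x\xi+ax^2)/b}\,dx . \] For $b=0$, $L_M$ is defined by the limit $b\to0$, which gives $(L_Mf)(\xi)=\theta\,\sqrt{|d|}\,e^{i\pi cd\xi^2}f(d\xi)$ with $\theta$ a constant of modulus $1$ (whose value is immaterial here). For a function $g$ on $\mathbb{R}$, $\operatorname{supp}(g)=\{x: g(x)\ne0\}$ (well-defined up to null sets). *)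

theory Defs
  imports "HOL-Analysis.Analysis"
begin

definition supp :: "(real \<Rightarrow> complex) \<Rightarrow> real set" where
  "supp g = {x. g x \<noteq> 0}"

(* The linear canonical transformation attached to M with rows (a, b) and (c, d).
   The unimodular constant of the degenerate case b = 0 is left unspecified in the
   source, so it is the parameter \<theta>; it plays no role when b \<noteq> 0. *)
definition lct :: "complex \<Rightarrow> real^2^2 \<Rightarrow> (real \<Rightarrow> complex) \<Rightarrow> real \<Rightarrow> complex" where
  "lct \<theta> M f \<xi> =
    (let a = M $ 1 $ 1; b = M $ 1 $ 2; c = M $ 2 $ 1; d = M $ 2 $ 2 in
     if b = 0 then
       \<theta> * of_real (sqrt \<bar>d\<bar>) * exp (\<i> * of_real (pi * c * d * \<xi>\<^sup>2)) * f (d * \<xi>)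
     else
       exp (- \<i> * of_real (pi * sgn b / 4)) / of_real (sqrt \<bar>b\<bar>) *
       (LINT x|lebesgue. f x * exp (\<i> * of_real (pi * (d * \<xi>\<^sup>2 - 2 * x * \<xi> + a * x\<^sup>2) / b))))"

end

theory Submission
  imports Defs "HOL-Probability.Characteristic_Functions"
begin

text \<open>
  Up to a factor of modulus \<open>1 / sqrt \<bar>b\<bar>\<close> and the scaling \<open>\<xi> \<mapsto> - 2 \<pi> \<xi> / b\<close>, the linear canonical transform with
  \<open>b \<noteq> 0\<close> is the Fourier transform of the chirped function \<open>g x = f x * exp (\<i> \<pi> a x\<^sup>2 / b)\<close>, which
  has the same modulus and support as \<open>f\<close> (\<open>norm_lct_eq_fourier\<close>). So the uncertainty principle
  comes from playing two \<open>L\<^sup>1\<close>-to-\<open>L\<^sup>\<infinity>\<close> bounds against each other, each turned into an \<open>L\<^sup>1\<close> bound by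
  the measure of a support. Writing \<open>Lf\<close> for the transform of \<open>f\<close>, the triangle inequality gives
  \<open>\<parallel>Lf\<parallel>\<^sub>\<infinity> \<le> \<parallel>f\<parallel>\<^sub>1 / sqrt \<bar>b\<bar>\<close>, hence
  \<open>\<parallel>Lf\<parallel>\<^sub>1 \<le> \<parallel>f\<parallel>\<^sub>1 * \<lambda>(supp Lf) / sqrt \<bar>b\<bar>\<close>; Fourier inversion would give symmetrically
  \<open>\<parallel>f\<parallel>\<^sub>1 \<le> \<parallel>Lf\<parallel>\<^sub>1 * \<lambda>(supp f) / sqrt \<bar>b\<bar>\<close>. Multiplying and cancelling \<open>0 < \<parallel>f\<parallel>\<^sub>1 < \<infinity>\<close> yields the claim.
  When \<open>b = 0\<close> there is nothing to prove.

  Instead of Fourier inversion, the second bound is obtained by duality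
  (\<open>nn_integral_norm_le_fourier_support\<close>): it suffices that
  \<open>\<bar>\<integral> g h\<bar> \<le> (1 / 2 \<pi>) * \<parallel>\<F> g\<parallel>\<^sub>1 * \<parallel>h\<parallel>\<^sub>1\<close> when \<open>h\<close> is the conjugate phase of \<open>g\<close> cut
  off to a bounded interval. For the Gaussian averages of an integrable \<open>h\<close> this is two applications
  of the multiplication formula \<open>\<integral> p (\<F> q) = \<integral> q (\<F> p)\<close>, since the Gaussian is its own Fourier
  transform (\<open>norm_integral_gaussian_average_le\<close>). Letting the Gaussian shrink gives it for \<open>h\<close>
  bounded and continuous, and approximating almost everywhere by continuous functions gives it for the
  discontinuous phase.
\<close>

section \<open>The Fourier transform on integrable functions\<close>

text \<open>
  The sign and the missing normalisation are those of the characteristic function of a probability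
  distribution, so that the known characteristic function of the normal distribution can be used.
  They are the reason for the factor \<open>1 / (2 * pi)\<close> in the bounds below.
\<close>

definition fourier :: "(real \<Rightarrow> complex) \<Rightarrow> real \<Rightarrow> complex" where
  "fourier g s = (LINT x|lborel. g x * iexp (s * x))"

lemma integrable_mult_bounded:
  fixes g h :: "'a \<Rightarrow> complex"
  assumes g: "integrable M g" and [measurable]: "h \<in> borel_measurable M"
    and bd: "\<And>x. norm (h x) \<le> B"
  shows "integrable M (\<lambda>x. g x * h x)"
proof (rule Bochner_Integration.integrable_bound)
  show "integrable M (\<lambda>x. B * norm (g x))" using g by auto
  show "(\<lambda>x. g x * h x) \<in> borel_measurable M" using g by measurable
  have "0 \<le> B" using norm_ge_zero bd order_trans by blast
  then show "AE x in M. norm (g x * h x) \<le> norm (B * norm (g x))"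
    using bd by (auto simp: norm_mult abs_mult mult.commute[of "norm (g _)"] intro!: mult_right_mono)
qed

lemma fourier_measurable [measurable]:
  assumes g: "integrable lborel g"
  shows "fourier g \<in> borel_measurable borel"
proof -
  have [measurable]: "g \<in> borel_measurable borel" using g by auto
  show ?thesis unfolding fourier_def by measurable
qed

lemma norm_fourier_le:
  shows "norm (fourier g s) \<le> (LINT x|lborel. norm (g x))"
  unfolding fourier_def by (rule order_trans[OF integral_norm_bound]) (simp add: norm_mult)

lemma fourier_multiplication_formula:
  assumes p: "integrable lborel p" and q: "integrable lborel q"
  shows "(LINT x|lborel. p x * fourier q (k * x)) = (LINT u|lborel. q u * fourier p (k * u))"
proof -
  have [measurable]: "p \<in> borel_measurable borel" "q \<in> borel_measurable borel" using p q by auto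
  have norm_K: "norm (p x * q u * iexp (k * x * u)) = norm (p x) * norm (q u)" for x u
    by (simp add: norm_mult flip: of_real_mult)
  have int: "integrable (lborel \<Otimes>\<^sub>M lborel) (\<lambda>(x, u). p x * q u * iexp (k * x * u))"
  proof (rule lborel_pair.Fubini_integrable)
    show "(\<lambda>(x, u). p x * q u * iexp (k * x * u)) \<in> borel_measurable (lborel \<Otimes>\<^sub>M lborel)" by measurable
    show "integrable lborel (\<lambda>x. LINT u|lborel. norm (case (x, u) of (x, u) \<Rightarrow> p x * q u * iexp (k * x * u)))"
      using p q by (simp add: norm_K del: of_real_mult)
    show "AE x in lborel. integrable lborel (\<lambda>u. case (x, u) of (x, u) \<Rightarrow> p x * q u * iexp (k * x * u))"
    proof (intro AE_I2)
      fix x :: real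
      have "integrable lborel (\<lambda>u. p x * q u)" using q by simp
      then show "integrable lborel (\<lambda>u. case (x, u) of (x, u) \<Rightarrow> p x * q u * iexp (k * x * u))"
        unfolding prod.case by (rule integrable_mult_bounded[where B=1]) (auto simp del: of_real_mult)
    qed
  qed
  have "(LINT x|lborel. p x * fourier q (k * x)) = (LINT x|lborel. LINT u|lborel. p x * q u * iexp (k * x * u))"
    by (simp add: fourier_def mult.assoc del: of_real_mult)
  also have "\<dots> = (LINT u|lborel. LINT x|lborel. p x * q u * iexp (k * x * u))"
    by (rule lborel_pair.Fubini_integral[OF int, symmetric])
  also have "\<dots> = (LINT u|lborel. q u * fourier p (k * u))"
    unfolding fourier_def integral_mult_right_zero[symmetric]
    by (intro Bochner_Integration.integral_cong refl) (simp add: mult_ac)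
  finally show ?thesis .
qed

section \<open>Testing against Gaussian averages and continuous functions\<close>

lemma fourier_std_normal_density:
  "fourier (\<lambda>u. of_real (std_normal_density u)) t = of_real (sqrt (2 * pi) * std_normal_density t)"
proof -
  have "fourier (\<lambda>u. of_real (std_normal_density u)) t = char std_normal_distribution t"
    unfolding fourier_def char_def by (subst integral_density) (auto simp: scaleR_conv_of_real normal_density_nonneg)
  also have "\<dots> = of_real (sqrt (2 * pi) * std_normal_density t)"
    unfolding char_std_normal_distribution by (simp add: std_normal_density_def)
  finally show ?thesis .
qed

text \<open>
  With \<open>k = 1 / \<epsilon>\<close>, the average of \<open>h\<close> is a convolution with a rescaled Gaussian. Writing the
  Gaussian as a Fourier transform and exchanging integrals shows that the average is itself, up to a
  constant, the Fourier transform of \<open>r u = std_normal_density u * fourier h (k * u)\<close> at \<open>- k * x\<close>.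
  A second exchange moves the transform onto \<open>g\<close>, and \<open>r\<close> is bounded by a multiple of \<open>\<parallel>h\<parallel>\<^sub>1\<close>. The
  powers of \<open>\<epsilon>\<close> cancel, which makes the limit \<open>\<epsilon> \<rightarrow> 0\<close> possible.
\<close>

lemma norm_integral_gaussian_average_le:
  assumes g: "integrable lborel g" and Fg: "integrable lborel (fourier g)"
    and h: "integrable lborel h" and \<epsilon>: "0 < \<epsilon>"
  shows "norm (LINT x|lborel. g x * (LINT z|lborel. of_real (std_normal_density z) * h (x + \<epsilon> * z)))
           \<le> 1 / (2 * pi) * (LINT s|lborel. norm (fourier g s)) * (LINT y|lborel. norm (h y))"
proof -
  define k where "k = 1 / \<epsilon>"
  define c where "c = k / sqrt (2 * pi)"
  define r where "r u = of_real (std_normal_density u) * fourier h (k * u)" for u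
  have k: "0 < k" using \<epsilon> by (simp add: k_def)
  have [measurable]: "h \<in> borel_measurable borel" "fourier h \<in> borel_measurable borel" "fourier g \<in> borel_measurable borel"
    using h g by auto
  have \<phi>: "integrable lborel (\<lambda>u. complex_of_real (std_normal_density u))" by (rule integrable_of_real) simp
  have r: "integrable lborel r"
    unfolding r_def by (rule integrable_mult_bounded[OF \<phi>, where B="LINT y|lborel. norm (h y)"]) (auto intro: norm_fourier_le)
  have average: "(LINT z|lborel. of_real (std_normal_density z) * h (x + \<epsilon> * z)) = of_real c * fourier r ((- k) * x)" for x
  proof -
    \<comment> \<open>the modulation by \<open>- k * x\<close> translates the transform of the Gaussian by \<open>x\<close>\<close>
    define q where "q u = of_real (std_normal_density u) * iexp (- (k * x * u))" for u
    have q: "integrable lborel q"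
      unfolding q_def by (rule integrable_mult_bounded[OF \<phi>, where B=1]) (auto simp del: of_real_mult)
    have Fq: "fourier q (k * y) = of_real (sqrt (2 * pi) * std_normal_density (k * (y - x)))" for y
      unfolding fourier_std_normal_density[symmetric] unfolding fourier_def q_def
      by (intro Bochner_Integration.integral_cong refl) (simp add: algebra_simps flip: exp_add)
    have "(LINT y|lborel. h y * of_real (std_normal_density (k * (y - x))))
            = \<epsilon> *\<^sub>R (LINT z|lborel. of_real (std_normal_density z) * h (x + \<epsilon> * z))"
      using \<epsilon> by (subst lborel_integral_real_affine[where c=\<epsilon> and t=x]) (auto simp: k_def mult.commute)
    then have "(LINT z|lborel. of_real (std_normal_density z) * h (x + \<epsilon> * z))
            = of_real k * (LINT y|lborel. h y * of_real (std_normal_density (k * (y - x))))"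
      using \<epsilon> by (simp add: k_def scaleR_conv_of_real)
    also have "\<dots> = of_real k * (LINT y|lborel. of_real (1 / sqrt (2 * pi)) * (h y * fourier q (k * y)))"
      unfolding Fq by simp
    also have "\<dots> = of_real c * (LINT y|lborel. h y * fourier q (k * y))"
      by (simp add: c_def)
    also have "\<dots> = of_real c * (LINT u|lborel. q u * fourier h (k * u))"
      by (simp add: fourier_multiplication_formula[OF h q])
    also have "(LINT u|lborel. q u * fourier h (k * u)) = fourier r ((- k) * x)"
      unfolding fourier_def[of r] r_def q_def
      by (intro Bochner_Integration.integral_cong refl) (simp add: mult_ac)
    finally show ?thesis .
  qed
  have "(LINT x|lborel. g x * (LINT z|lborel. of_real (std_normal_density z) * h (x + \<epsilon> * z)))
      = of_real c * (LINT x|lborel. g x * fourier r ((- k) * x))"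
    unfolding average by (simp add: mult.left_commute)
  also have "\<dots> = of_real c * (LINT u|lborel. r u * fourier g ((- k) * u))"
    by (simp only: fourier_multiplication_formula[OF g r])
  finally have eq: "norm (LINT x|lborel. g x * (LINT z|lborel. of_real (std_normal_density z) * h (x + \<epsilon> * z)))
      = c * norm (LINT u|lborel. r u * fourier g ((- k) * u))"
    using k by (simp add: norm_mult norm_divide c_def)
  have "std_normal_density u \<le> 1 / sqrt (2 * pi)" for u
    by (simp add: std_normal_density_def divide_right_mono)
  then have norm_r: "norm (r u) \<le> 1 / sqrt (2 * pi) * (LINT y|lborel. norm (h y))" for u
    unfolding r_def norm_mult
    by (intro mult_mono norm_fourier_le) auto
  have Fgk: "integrable lborel (\<lambda>u. norm (fourier g (- k * u)))"
    using lborel_integrable_real_affine[of "\<lambda>s. norm (fourier g s)" "-k" 0] Fg k by auto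
  have "norm (LINT u|lborel. r u * fourier g ((- k) * u))
      \<le> (LINT u|lborel. 1 / sqrt (2 * pi) * (LINT y|lborel. norm (h y)) * norm (fourier g (- k * u)))"
  proof (rule Bochner_Integration.integral_norm_bound_integral)
    show "integrable lborel (\<lambda>u. r u * fourier g (- k * u))"
      by (rule integrable_mult_bounded[OF r, where B="LINT x|lborel. norm (g x)"]) (auto intro: norm_fourier_le)
    show "integrable lborel (\<lambda>u. 1 / sqrt (2 * pi) * (LINT y|lborel. norm (h y)) * norm (fourier g (- k * u)))"
      using Fgk by (rule integrable_mult_right)
    show "norm (r u * fourier g (- k * u)) \<le> 1 / sqrt (2 * pi) * (LINT y|lborel. norm (h y)) * norm (fourier g (- k * u))" for u
      unfolding norm_mult by (intro mult_right_mono norm_r) auto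
  qed
  also have "\<dots> = 1 / sqrt (2 * pi) * (LINT y|lborel. norm (h y)) * ((LINT s|lborel. norm (fourier g s)) / k)"
    using lborel_integral_real_affine[of "-k" "\<lambda>s. norm (fourier g s)" 0] k by simp
  finally have "c * norm (LINT u|lborel. r u * fourier g ((- k) * u))
      \<le> c * (1 / sqrt (2 * pi) * (LINT y|lborel. norm (h y)) * ((LINT s|lborel. norm (fourier g s)) / k))"
    using k by (intro mult_left_mono) (auto simp: c_def)
  also have "\<dots> = 1 / (2 * pi) * (LINT s|lborel. norm (fourier g s)) * (LINT y|lborel. norm (h y))"
    using k by (simp add: c_def field_simps)
  finally show ?thesis unfolding eq .
qed

text \<open>
  As \<open>\<epsilon> \<rightarrow> 0\<close> the Gaussian averages of a bounded continuous function converge pointwise to it and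
  keep its bound, so dominated convergence passes the previous estimate to the limit.
\<close>

lemma norm_integral_mult_continuous_le:
  assumes g: "integrable lborel g" and Fg: "integrable lborel (fourier g)"
    and h: "integrable lborel h" and cont: "continuous_on UNIV h" and bd: "\<And>x. norm (h x) \<le> B"
  shows "norm (LINT x|lborel. g x * h x)
           \<le> 1 / (2 * pi) * (LINT s|lborel. norm (fourier g s)) * (LINT y|lborel. norm (h y))"
proof -
  define \<epsilon> where "\<epsilon> n = inverse (real (Suc n))" for n
  define A where "A n x = (LINT z|lborel. of_real (std_normal_density z) * h (x + \<epsilon> n * z))" for n x
  have [measurable]: "h \<in> borel_measurable borel" "g \<in> borel_measurable borel"
    using h g by auto
  have A_meas [measurable]: "A n \<in> borel_measurable borel" for n unfolding A_def by measurable
  have \<phi>: "integrable lborel (\<lambda>u. complex_of_real (std_normal_density u))" by (rule integrable_of_real) simp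
  have one: "(LINT u|lborel. std_normal_density u) = 1" by simp
  have B0: "0 \<le> B" using norm_ge_zero bd order_trans by blast
  have A_bd: "norm (A n x) \<le> B" for n x
  proof -
    have "norm (A n x) \<le> (LINT z|lborel. std_normal_density z * B)"
      unfolding A_def
    proof (rule Bochner_Integration.integral_norm_bound_integral)
      show "integrable lborel (\<lambda>z. of_real (std_normal_density z) * h (x + \<epsilon> n * z))"
        by (rule integrable_mult_bounded[OF \<phi>, where B=B]) (auto intro: bd)
      show "norm (of_real (std_normal_density z) * h (x + \<epsilon> n * z)) \<le> std_normal_density z * B" for z
        unfolding norm_mult by (intro mult_mono bd) auto
    qed auto
    then show ?thesis by simp
  qed
  have A_lim: "(\<lambda>n. A n x) \<longlonglongrightarrow> h x" for x
  proof -
    have "(\<lambda>n. A n x) \<longlonglongrightarrow> (LINT z|lborel. of_real (std_normal_density z) * h x)"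
      unfolding A_def
    proof (rule integral_dominated_convergence[where w="\<lambda>z. std_normal_density z * B"])
      have "(\<lambda>n. x + \<epsilon> n * z) \<longlonglongrightarrow> x + 0 * z" for z
        unfolding \<epsilon>_def by (intro tendsto_intros LIMSEQ_inverse_real_of_nat)
      then have "(\<lambda>n. h (x + \<epsilon> n * z)) \<longlonglongrightarrow> h x" for z
        using cont by (auto simp: continuous_on_eq_continuous_at intro: isCont_tendsto_compose)
      then show "AE z in lborel. (\<lambda>n. of_real (std_normal_density z) * h (x + \<epsilon> n * z)) \<longlonglongrightarrow> of_real (std_normal_density z) * h x"
        by (auto intro!: tendsto_intros)
      show "AE z in lborel. norm (of_real (std_normal_density z) * h (x + \<epsilon> n * z)) \<le> std_normal_density z * B" for n
        unfolding norm_mult by (intro AE_I2 mult_mono bd) auto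
    qed (auto simp del: of_real_mult)
    also have "(LINT z|lborel. of_real (std_normal_density z) * h x) = h x"
      using \<phi> one by simp
    finally show ?thesis .
  qed
  have "(\<lambda>n. LINT x|lborel. g x * A n x) \<longlonglongrightarrow> (LINT x|lborel. g x * h x)"
  proof (rule integral_dominated_convergence[where w="\<lambda>x. norm (g x) * B"])
    show "AE x in lborel. (\<lambda>n. g x * A n x) \<longlonglongrightarrow> g x * h x" by (intro AE_I2 tendsto_intros A_lim)
    show "AE x in lborel. norm (g x * A n x) \<le> norm (g x) * B" for n
      unfolding norm_mult by (intro AE_I2 mult_left_mono A_bd) auto
  qed (use g in auto)
  then have "(\<lambda>n. norm (LINT x|lborel. g x * A n x)) \<longlonglongrightarrow> norm (LINT x|lborel. g x * h x)"
    by (rule tendsto_norm)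
  then show ?thesis
    by (rule LIMSEQ_le_const2)
       (auto simp: A_def \<epsilon>_def intro!: norm_integral_gaussian_average_le[OF g Fg h, simplified])
qed


section \<open>Testing against the phase\<close>

text \<open>
  Measurable functions are almost everywhere limits of continuous ones. To make dominated convergence
  available both for \<open>\<integral> g v\<^sub>n\<close> and for \<open>\<parallel>v\<^sub>n\<parallel>\<^sub>1\<close>, the approximants are retracted onto the unit disc
  by \<open>P\<close> and multiplied by a continuous cutoff that equals \<open>1\<close> on \<open>[-N, N]\<close> and vanishes outside
  \<open>[-N - 1, N + 1]\<close>; neither operation changes the limit.
\<close>

lemma exists_continuous_approximation:
  fixes w :: "real \<Rightarrow> complex"
  assumes [measurable]: "w \<in> borel_measurable borel" and bd: "\<And>x. norm (w x) \<le> 1"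
    and supp_w: "\<And>x. N < \<bar>x\<bar> \<Longrightarrow> w x = 0"
  obtains v where "\<And>n. continuous_on UNIV (v n)"
    and "\<And>n x. norm (v n x) \<le> indicator {-(N + 1)..N + 1} x"
    and "AE x in lborel. (\<lambda>n. v n x) \<longlonglongrightarrow> w x"
proof -
  have "w measurable_on UNIV"
    by (intro lebesgue_measurable_imp_measurable_on) (auto intro: measurable_completion)
  then obtain Z u where Z: "negligible Z" and u: "\<And>n. continuous_on UNIV (u n)"
    and lim: "\<And>x. x \<notin> Z \<Longrightarrow> (\<lambda>n. u n x) \<longlonglongrightarrow> w x"
    by (auto simp: measurable_on_def)
  define cutoff where "cutoff x = max 0 (min 1 (N + 1 - \<bar>x\<bar>))" for x :: real
  define P where "P z = z / of_real (max 1 (norm z))" for z :: complex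
  define v where "v n x = of_real (cutoff x) * P (u n x)" for n x
  have P_norm: "norm (P z) \<le> 1" for z
    by (auto simp: P_def norm_divide divide_simps)
  have P_id: "P z = z" if "norm z \<le> 1" for z
    using that by (auto simp: P_def max_def)
  have P_cont: "continuous_on UNIV P"
    unfolding P_def by (intro continuous_intros) (auto simp: max_def)
  show ?thesis
  proof
    show "continuous_on UNIV (v n)" for n
      unfolding v_def cutoff_def
      by (intro continuous_intros continuous_on_compose2[OF P_cont] u) auto
    show "norm (v n x) \<le> indicator {-(N + 1)..N + 1} x" for n x
    proof (cases "\<bar>x\<bar> \<le> N + 1")
      case True
      have "norm (v n x) \<le> 1 * 1"
        unfolding v_def norm_mult by (intro mult_mono P_norm) (auto simp: cutoff_def)
      then show ?thesis using True by (auto simp: indicator_def abs_le_iff)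
    qed (auto simp: v_def cutoff_def)
    have "(\<lambda>n. v n x) \<longlonglongrightarrow> w x" if "x \<notin> Z" for x
    proof -
      have "(\<lambda>n. v n x) \<longlonglongrightarrow> of_real (cutoff x) * P (w x)"
        unfolding v_def using lim[OF that] P_cont
        by (intro tendsto_intros) (auto simp: continuous_on_eq_continuous_at intro: isCont_tendsto_compose)
      also have "of_real (cutoff x) * P (w x) = w x"
        unfolding P_id[OF bd] using supp_w[of x] by (cases "N < \<bar>x\<bar>") (auto simp: cutoff_def)
      finally show ?thesis .
    qed
    moreover have "AE x in lebesgue. x \<notin> Z"
      using Z by (auto simp: negligible_iff_null_sets intro: AE_not_in)
    ultimately have "AE x in lebesgue. (\<lambda>n. v n x) \<longlonglongrightarrow> w x" by auto
    then show "AE x in lborel. (\<lambda>n. v n x) \<longlonglongrightarrow> w x" by (simp add: AE_completion_iff)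
  qed
qed

text \<open>
  The test function \<open>w\<close> turns \<open>\<integral> g w\<close> into the integral of \<open>\<bar>g\<bar>\<close> over the interval, while \<open>\<parallel>w\<parallel>\<^sub>1\<close>
  is the measure of the part of the support in the interval. The interval makes this measure finite
  even if the support is not.
\<close>

lemma integral_norm_on_interval_le:
  assumes g: "integrable lborel g" and Fg: "integrable lborel (fourier g)"
  shows "(LINT x|lborel. indicator {-N..N} x * norm (g x))
           \<le> 1 / (2 * pi) * (LINT s|lborel. norm (fourier g s)) * measure lborel ({-N..N} \<inter> supp g)"
proof -
  define C where "C = 1 / (2 * pi) * (LINT s|lborel. norm (fourier g s))"
  have [measurable]: "g \<in> borel_measurable borel" using g by auto
  have [measurable]: "cnj \<in> borel_measurable borel"
    by (intro borel_measurable_continuous_onI continuous_intros)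
  define w where "w x = indicator {-N..N} x * cnj (sgn (g x))" for x
  have w_meas [measurable]: "w \<in> borel_measurable borel"
    unfolding w_def sgn_div_norm by measurable
  have norm_w: "norm (w x) = indicator ({-N..N} \<inter> supp g) x" for x
    by (auto simp: w_def norm_mult norm_sgn supp_def indicator_def)
  obtain v where v_cont: "\<And>n. continuous_on UNIV (v n)"
    and v_bd: "\<And>n x. norm (v n x) \<le> indicator {-(N + 1)..N + 1} x"
    and v_lim: "AE x in lborel. (\<lambda>n. v n x) \<longlonglongrightarrow> w x"
  proof (rule exists_continuous_approximation[of w N])
    show "norm (w x) \<le> 1" for x unfolding norm_w by (simp add: indicator_def)
    show "w x = 0" if "N < \<bar>x\<bar>" for x using that by (auto simp: w_def indicator_def)
  qed auto
  have v_bd1: "norm (v n x) \<le> 1" for n x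
    by (rule order_trans[OF v_bd]) (simp add: indicator_def)
  have v_meas [measurable]: "v n \<in> borel_measurable borel" for n
    using v_cont by (rule borel_measurable_continuous_onI)
  have box: "integrable lborel (indicator {-(N + 1)..N + 1} :: real \<Rightarrow> real)"
    by (rule integrable_real_indicator) (auto simp: emeasure_lborel_Icc_eq)
  have v_int: "integrable lborel (v n)" for n
    using box by (rule Bochner_Integration.integrable_bound) (use v_bd in auto)
  have le: "norm (LINT x|lborel. g x * v n x) \<le> C * (LINT y|lborel. norm (v n y))" for n
    unfolding C_def by (rule norm_integral_mult_continuous_le[OF g Fg v_int v_cont v_bd1])
  have lim_g: "(\<lambda>n. LINT x|lborel. g x * v n x) \<longlonglongrightarrow> (LINT x|lborel. g x * w x)"
  proof (rule integral_dominated_convergence[where w="\<lambda>x. norm (g x) * 1"])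
    show "AE x in lborel. (\<lambda>n. g x * v n x) \<longlonglongrightarrow> g x * w x"
      using v_lim by eventually_elim (intro tendsto_intros)
    show "AE x in lborel. norm (g x * v n x) \<le> norm (g x) * 1" for n
      unfolding norm_mult by (intro AE_I2 mult_left_mono v_bd1) auto
  qed (use g in auto)
  have lim_v: "(\<lambda>n. LINT x|lborel. norm (v n x)) \<longlonglongrightarrow> (LINT x|lborel. norm (w x))"
  proof (rule integral_dominated_convergence[where w="indicator {-(N + 1)..N + 1}"])
    show "AE x in lborel. (\<lambda>n. norm (v n x)) \<longlonglongrightarrow> norm (w x)"
      using v_lim by eventually_elim (intro tendsto_intros)
    show "AE x in lborel. norm (norm (v n x)) \<le> indicator {-(N + 1)..N + 1} x" for n
      using v_bd by auto
  qed (use box in auto)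
  have "norm (LINT x|lborel. g x * w x) \<le> C * (LINT x|lborel. norm (w x))"
    by (rule LIMSEQ_le[OF tendsto_norm[OF lim_g] tendsto_mult_left[OF lim_v]]) (use le in auto)
  moreover have "(LINT x|lborel. norm (w x)) = measure lborel ({-N..N} \<inter> supp g)"
    unfolding norm_w by simp
  moreover have "(LINT x|lborel. g x * w x) = of_real (LINT x|lborel. indicator {-N..N} x * norm (g x))"
  proof -
    have "g x * w x = of_real (indicator {-N..N} x * norm (g x))" for x
    proof -
      have "g x * cnj (sgn (g x)) = of_real (norm (g x))"
        by (simp add: sgn_eq complex_norm_square[symmetric] power2_eq_square)
      then show ?thesis by (simp add: w_def indicator_def)
    qed
    then show ?thesis by (simp only: integral_complex_of_real)
  qed
  ultimately show ?thesis unfolding C_def by simp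
qed

text \<open>
  This replaces the inversion bound \<open>\<parallel>g\<parallel>\<^sub>\<infinity> \<le> (1 / 2 \<pi>) * \<parallel>\<F> g\<parallel>\<^sub>1\<close>. It follows by exhausting the line
  with intervals; extended nonnegative values cover supports of infinite measure.
\<close>

lemma nn_integral_norm_le_fourier_support:
  assumes g: "integrable lborel g" and Fg: "integrable lborel (fourier g)"
  shows "(\<integral>\<^sup>+x. norm (g x) \<partial>lborel)
           \<le> ennreal (1 / (2 * pi)) * (\<integral>\<^sup>+s. norm (fourier g s) \<partial>lborel) * emeasure lborel (supp g)"
proof -
  define C where "C = 1 / (2 * pi) * (LINT s|lborel. norm (fourier g s))"
  have C0: "0 \<le> C" by (auto simp: C_def)
  have [measurable]: "g \<in> borel_measurable borel" using g by auto
  have [measurable]: "supp g \<in> sets borel" unfolding supp_def by measurable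
  have le: "ennreal (LINT x|lborel. indicator {-real n..real n} x * norm (g x)) \<le> ennreal C * emeasure lborel (supp g)" for n
  proof -
    have fin: "emeasure lborel ({-real n..real n} \<inter> supp g) \<noteq> \<infinity>"
      using emeasure_mono[of "{-real n..real n} \<inter> supp g" "{-real n..real n}" lborel] by (auto simp: top_unique)
    have "ennreal (LINT x|lborel. indicator {-real n..real n} x * norm (g x))
        \<le> ennreal (C * measure lborel ({-real n..real n} \<inter> supp g))"
      unfolding C_def by (intro ennreal_leI integral_norm_on_interval_le g Fg)
    also have "\<dots> = ennreal C * emeasure lborel ({-real n..real n} \<inter> supp g)"
      using fin C0 by (simp add: ennreal_mult emeasure_eq_ennreal_measure)
    also have "\<dots> \<le> ennreal C * emeasure lborel (supp g)"
      by (intro mult_left_mono emeasure_mono) auto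
    finally show ?thesis .
  qed
  have "(\<lambda>n. LINT x|lborel. indicator {-real n..real n} x * norm (g x)) \<longlonglongrightarrow> (LINT x|lborel. norm (g x))"
  proof (rule integral_dominated_convergence[where w="\<lambda>x. norm (g x)"])
    have "(\<lambda>n. indicator {-real n..real n} x * norm (g x)) \<longlonglongrightarrow> norm (g x)" for x
    proof (rule tendsto_eventually)
      obtain m where "\<bar>x\<bar> \<le> real m" using real_arch_simple by blast
      then show "\<forall>\<^sub>F n in sequentially. indicator {-real n..real n} x * norm (g x) = norm (g x)"
        by (intro eventually_sequentiallyI[of m]) (auto simp: indicator_def)
    qed
    then show "AE x in lborel. (\<lambda>n. indicator {-real n..real n} x * norm (g x)) \<longlonglongrightarrow> norm (g x)" by simp
  qed (use g in \<open>auto simp: indicator_def\<close>)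
  then have "ennreal (LINT x|lborel. norm (g x)) \<le> ennreal C * emeasure lborel (supp g)"
    by (intro LIMSEQ_le_const2[OF tendsto_ennrealI]) (use le in auto)
  then show ?thesis
    unfolding C_def using g Fg by (simp add: nn_integral_eq_integral flip: ennreal_mult)
qed

section \<open>The linear canonical transform\<close>

lemma supp_in_sets_lebesgue:
  "f \<in> borel_measurable lebesgue \<Longrightarrow> supp f \<in> sets lebesgue"
  using measurable_sets[of f lebesgue borel "- {0}"] by (simp add: supp_def vimage_def)

lemma borel_representative_complex:
  fixes f :: "'a \<Rightarrow> complex"
  assumes [measurable]: "f \<in> borel_measurable (completion M)"
  obtains f0 where "f0 \<in> borel_measurable M" "AE x in M. f x = f0 x"
proof -
  obtain r where [measurable]: "r \<in> borel_measurable M" and r: "AE x in M. Re (f x) = r x"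
    using completion_ex_borel_measurable_real[of "\<lambda>x. Re (f x)" M] by auto
  obtain i where [measurable]: "i \<in> borel_measurable M" and i: "AE x in M. Im (f x) = i x"
    using completion_ex_borel_measurable_real[of "\<lambda>x. Im (f x)" M] by auto
  show ?thesis
  proof
    show "(\<lambda>x. of_real (r x) + \<i> * of_real (i x)) \<in> borel_measurable M" by measurable
    show "AE x in M. f x = of_real (r x) + \<i> * of_real (i x)"
      using r i by eventually_elim (simp add: complex_eq_iff)
  qed
qed

text \<open>
  Expanding the quadratic exponent separates a factor \<open>exp (\<i> \<pi> d \<xi>\<^sup>2 / b)\<close> of modulus \<open>1\<close>, the chirp in
  \<open>x\<close>, and the Fourier kernel. The chirped function enters only through a Borel representative \<open>g\<close>,
  because the transform is an integral over the completed measure while Fubini's theorem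
  is used on its Borel part.
\<close>

lemma norm_lct_eq_fourier:
  fixes M :: "real^2^2"
  assumes b: "M $ 1 $ 2 \<noteq> 0" and g: "integrable lborel g"
    and fg: "AE x in lborel. f x * iexp (pi * (M $ 1 $ 1) * x\<^sup>2 / (M $ 1 $ 2)) = g x"
    and f: "f \<in> borel_measurable lebesgue"
  shows "norm (lct \<theta> M f \<xi>) = norm (fourier g (- (2 * pi / M $ 1 $ 2) * \<xi>)) / sqrt \<bar>M $ 1 $ 2\<bar>"
proof -
  define a b d where abd: "a = M $ 1 $ 1" "b = M $ 1 $ 2" "d = M $ 2 $ 2"
  have b0: "b \<noteq> 0" using b by (simp add: abd)
  have [measurable]: "g \<in> borel_measurable borel" using g by auto
  have "(LINT x|lebesgue. f x * exp (\<i> * of_real (pi * (d * \<xi>\<^sup>2 - 2 * x * \<xi> + a * x\<^sup>2) / b)))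
      = (LINT x|lebesgue. iexp (pi * d * \<xi>\<^sup>2 / b) * (g x * iexp ((- (2 * pi / b) * \<xi>) * x)))"
  proof (rule integral_cong_AE)
    have split: "iexp (pi * (d * \<xi>\<^sup>2 - 2 * x * \<xi> + a * x\<^sup>2) / b)
       = iexp (pi * a * x\<^sup>2 / b) * (iexp (pi * d * \<xi>\<^sup>2 / b) * iexp ((- (2 * pi / b) * \<xi>) * x))" for x
    proof -
      have "pi * (d * \<xi>\<^sup>2 - 2 * x * \<xi> + a * x\<^sup>2) / b = pi * a * x\<^sup>2 / b + (pi * d * \<xi>\<^sup>2 / b + (- (2 * pi / b) * \<xi>) * x)"
        using b0 by (simp add: field_simps)
      then show ?thesis by (simp only: of_real_add distrib_left exp_add)
    qed
    show "AE x in lebesgue. f x * iexp (pi * (d * \<xi>\<^sup>2 - 2 * x * \<xi> + a * x\<^sup>2) / b)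
        = iexp (pi * d * \<xi>\<^sup>2 / b) * (g x * iexp ((- (2 * pi / b) * \<xi>) * x))"
      using AE_completion[OF fg]
    proof eventually_elim
      case (elim x)
      then show ?case unfolding split by (simp only: abd mult_ac flip: elim)
    qed
    show "(\<lambda>x. f x * iexp (pi * (d * \<xi>\<^sup>2 - 2 * x * \<xi> + a * x\<^sup>2) / b)) \<in> borel_measurable lebesgue"
      by (intro borel_measurable_times f measurable_completion) measurable
    show "(\<lambda>x. iexp (pi * d * \<xi>\<^sup>2 / b) * (g x * iexp ((- (2 * pi / b) * \<xi>) * x))) \<in> borel_measurable lebesgue"
      by (intro measurable_completion) measurable
  qed
  also have "\<dots> = iexp (pi * d * \<xi>\<^sup>2 / b) * fourier g (- (2 * pi / b) * \<xi>)"
    unfolding fourier_def by (subst integral_completion) auto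
  finally have "lct \<theta> M f \<xi> = iexp (- (pi * sgn b / 4)) / of_real (sqrt \<bar>b\<bar>) * (iexp (pi * d * \<xi>\<^sup>2 / b) * fourier g (- (2 * pi / b) * \<xi>))"
    using b0 unfolding lct_def Let_def abd[symmetric] by simp
  then show ?thesis
    unfolding abd[symmetric] by (simp only: norm_mult norm_divide norm_exp_i_times norm_of_real) simp
qed


theorem corollary4p8:
  fixes M :: "real^2^2" and f :: "real \<Rightarrow> complex" and \<theta> :: complex
  assumes SL2: "det M = 1"
    and theta: "norm \<theta> = 1"
    and nonzero: "\<not> (AE x in lebesgue. f x = 0)"
    and f_L1: "integrable lebesgue f"
    and Lf_L1: "integrable lebesgue (lct \<theta> M f)"
  shows "emeasure lebesgue (supp f) * emeasure lebesgue (supp (lct \<theta> M f)) \<ge> ennreal \<bar>M $ 1 $ 2\<bar>"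
proof (cases "M $ 1 $ 2 = 0")
  case True
  then show ?thesis by simp
next
  case False
  define a b where ab: "a = M $ 1 $ 1" "b = M $ 1 $ 2"
  define L where "L = lct \<theta> M f"
  have b0: "b \<noteq> 0" using False by (simp add: ab)
  have f_meas [measurable]: "f \<in> borel_measurable lebesgue" and L_meas [measurable]: "L \<in> borel_measurable lebesgue"
    using f_L1 Lf_L1 by (auto simp: L_def)
  obtain f0 where [measurable]: "f0 \<in> borel_measurable borel" and f0: "AE x in lborel. f x = f0 x"
    using borel_representative_complex[of f lborel] by auto
  define g where "g x = f0 x * iexp (pi * a * x\<^sup>2 / b)" for x
  have g_meas [measurable]: "g \<in> borel_measurable borel" unfolding g_def by measurable
  have norm_g: "norm (g x) = norm (f0 x)" for x
    by (simp only: g_def norm_mult norm_exp_i_times)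
  have int_norm_g: "(\<integral>\<^sup>+x. norm (g x) \<partial>lborel) = (\<integral>\<^sup>+x. norm (f x) \<partial>lebesgue)"
    unfolding nn_integral_completion norm_g using f0 by (intro nn_integral_cong_AE) auto
  have g: "integrable lborel g"
    using f_L1 by (simp add: integrable_iff_bounded int_norm_g)
  have norm_L: "norm (L \<xi>) = norm (fourier g (- (2 * pi / b) * \<xi>)) / sqrt \<bar>b\<bar>" for \<xi>
    unfolding L_def ab
  proof (rule norm_lct_eq_fourier[OF False g _ f_meas])
    show "AE x in lborel. f x * iexp (pi * (M $ 1 $ 1) * x\<^sup>2 / (M $ 1 $ 2)) = g x"
      using f0 by eventually_elim (simp add: g_def ab)
  qed

  \<comment> \<open>\<open>I\<close> is \<open>\<parallel>f\<parallel>\<^sub>1\<close>, the quantity that is cancelled at the end\<close>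
  define I where "I = (LINT x|lborel. norm (g x))"
  have I: "(\<integral>\<^sup>+x. norm (g x) \<partial>lborel) = ennreal I"
    unfolding I_def using g by (simp add: nn_integral_eq_integral)
  have "I \<noteq> 0"
  proof
    assume "I = 0"
    then have "AE x in lborel. g x = 0" using I by (simp add: nn_integral_0_iff_AE)
    then have "AE x in lborel. f x = 0"
      using f0 by eventually_elim (simp add: g_def)
    then show False using nonzero AE_completion by blast
  qed
  then have I0: "0 < I" by (simp add: I_def less_le)

  define S where "S = emeasure lebesgue (supp f)"
  define T where "T = emeasure lebesgue (supp L)"
  have S: "emeasure lborel (supp g) = S"
  proof -
    have "emeasure lborel (supp g) = emeasure lebesgue (supp g)"
      by (simp add: supp_def)
    also have "\<dots> = S"
      unfolding S_def
    proof (rule emeasure_eq_AE)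
      show "AE x in lebesgue. x \<in> supp g \<longleftrightarrow> x \<in> supp f"
        using AE_completion[OF f0] by eventually_elim (simp add: supp_def g_def)
    qed (auto intro: supp_in_sets_lebesgue simp: measurable_completion)
    finally show ?thesis .
  qed

  have sup_L: "norm (L \<xi>) \<le> I / sqrt \<bar>b\<bar>" for \<xi>
    unfolding norm_L I_def by (intro divide_right_mono norm_fourier_le) auto
  have L_le: "(\<integral>\<^sup>+\<xi>. norm (L \<xi>) \<partial>lebesgue) \<le> ennreal (I / sqrt \<bar>b\<bar>) * T"
  proof -
    have "(\<integral>\<^sup>+\<xi>. norm (L \<xi>) \<partial>lebesgue) \<le> (\<integral>\<^sup>+\<xi>. ennreal (I / sqrt \<bar>b\<bar>) * indicator (supp L) \<xi> \<partial>lebesgue)"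
      using sup_L by (intro nn_integral_mono) (auto simp: supp_def indicator_def intro: ennreal_leI)
    also have "\<dots> = ennreal (I / sqrt \<bar>b\<bar>) * T"
      unfolding T_def by (intro nn_integral_cmult_indicator supp_in_sets_lebesgue L_meas)
    finally show ?thesis .
  qed

  have Fg_meas [measurable]: "fourier g \<in> borel_measurable borel" using g by (rule fourier_measurable)
  have fourier_L: "(\<integral>\<^sup>+s. norm (fourier g s) \<partial>lborel)
      = ennreal (2 * pi / sqrt \<bar>b\<bar>) * (\<integral>\<^sup>+\<xi>. norm (L \<xi>) \<partial>lebesgue)"
  proof -
    have "(\<integral>\<^sup>+s. norm (fourier g s) \<partial>lborel)
        = ennreal \<bar>- (2 * pi / b)\<bar> * (\<integral>\<^sup>+\<xi>. norm (fourier g (0 + (- (2 * pi / b)) * \<xi>)) \<partial>lborel)"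
      by (rule nn_integral_real_affine) (use b0 in auto)
    also have "(\<integral>\<^sup>+\<xi>. norm (fourier g (0 + (- (2 * pi / b)) * \<xi>)) \<partial>lborel)
        = (\<integral>\<^sup>+\<xi>. ennreal (sqrt \<bar>b\<bar>) * norm (L \<xi>) \<partial>lborel)"
      unfolding norm_L using b0 by (intro nn_integral_cong) (simp flip: ennreal_mult)
    also have "\<dots> = (\<integral>\<^sup>+\<xi>. ennreal (sqrt \<bar>b\<bar>) * norm (L \<xi>) \<partial>lebesgue)"
      by (simp add: nn_integral_completion)
    also have "\<dots> = ennreal (sqrt \<bar>b\<bar>) * (\<integral>\<^sup>+\<xi>. norm (L \<xi>) \<partial>lebesgue)"
      by (rule nn_integral_cmult) measurable
    also have "ennreal \<bar>- (2 * pi / b)\<bar> * (ennreal (sqrt \<bar>b\<bar>) * (\<integral>\<^sup>+\<xi>. norm (L \<xi>) \<partial>lebesgue))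
        = ennreal (\<bar>- (2 * pi / b)\<bar> * sqrt \<bar>b\<bar>) * (\<integral>\<^sup>+\<xi>. norm (L \<xi>) \<partial>lebesgue)"
      by (simp only: ennreal_mult abs_ge_zero real_sqrt_ge_zero mult.assoc)
    also have "\<bar>- (2 * pi / b)\<bar> * sqrt \<bar>b\<bar> = 2 * pi / sqrt \<bar>b\<bar>"
      using b0 by (simp add: abs_mult real_div_sqrt field_simps flip: power2_eq_square)
    finally show ?thesis .
  qed
  have "(\<integral>\<^sup>+\<xi>. norm (L \<xi>) \<partial>lebesgue) < \<infinity>"
    using Lf_L1 by (simp add: integrable_iff_bounded L_def)
  then have Fg: "integrable lborel (fourier g)"
    by (simp add: integrable_iff_bounded fourier_L ennreal_mult_less_top)

  have constants: "ennreal (1 / (2 * pi)) * ennreal (2 * pi / sqrt \<bar>b\<bar>) * ennreal (I / sqrt \<bar>b\<bar>) = ennreal (I / \<bar>b\<bar>)"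
  proof -
    have "1 / (2 * pi) * (2 * pi / sqrt \<bar>b\<bar>) * (I / sqrt \<bar>b\<bar>) = I / \<bar>b\<bar>"
      using b0 by (simp add: field_simps)
    moreover have "ennreal (1 / (2 * pi)) * ennreal (2 * pi / sqrt \<bar>b\<bar>) * ennreal (I / sqrt \<bar>b\<bar>)
        = ennreal (1 / (2 * pi) * (2 * pi / sqrt \<bar>b\<bar>) * (I / sqrt \<bar>b\<bar>))"
      using I0 by (subst ennreal_mult[symmetric], simp, simp)+ (rule refl)
    ultimately show ?thesis by simp
  qed
  have "ennreal I \<le> ennreal (1 / (2 * pi)) * (ennreal (2 * pi / sqrt \<bar>b\<bar>) * (\<integral>\<^sup>+\<xi>. norm (L \<xi>) \<partial>lebesgue)) * S"
    using nn_integral_norm_le_fourier_support[OF g Fg] unfolding I fourier_L S .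
  also have "\<dots> \<le> ennreal (1 / (2 * pi)) * (ennreal (2 * pi / sqrt \<bar>b\<bar>) * (ennreal (I / sqrt \<bar>b\<bar>) * T)) * S"
    by (intro mult_right_mono mult_left_mono L_le) auto
  also have "\<dots> = ennreal (I / \<bar>b\<bar>) * (S * T)"
    unfolding constants[symmetric] by (simp only: mult_ac)
  finally have main: "ennreal I \<le> ennreal (I / \<bar>b\<bar>) * (S * T)" .
  have "ennreal \<bar>b\<bar> \<le> S * T"
  proof (cases "S * T")
    case (real p)
    have "ennreal I \<le> ennreal (I / \<bar>b\<bar> * p)"
      using main unfolding real(2) by (subst ennreal_mult) (use I0 real(1) in auto)
    moreover have "0 \<le> I / \<bar>b\<bar> * p" using I0 real(1) by simp
    ultimately have "I \<le> I / \<bar>b\<bar> * p" by (simp only: ennreal_le_iff)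
    then have "\<bar>b\<bar> \<le> p" using I0 b0 by (simp add: field_simps)
    then show ?thesis using real by (simp add: ennreal_leI)
  qed simp
  then show ?thesis by (simp add: S_def T_def L_def ab)
qed

end
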